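(* Let $\tau_+,\tau_-,\sigma$ be the automorphisms of $\mathrm{Sk}_{A,\lambda}(S_{1,1})$ induced by the generators of the mapping class group $\mathrm{SL}_2(\mathbb{Z})$ of $S_{1,1}$, and let $\mathrm{Sk}_{A,\lambda}(S_{1,1})^{\xi_i}$ denote the subalgebra of invariants of the involution $\xi_i$, $i=1,2,3$. Then these automorphisms restrict to isomorphisms between the invariant subalgebras as follows: - $\tau_+$ maps $\mathrm{Sk}_{A,\lambda}(S_{1,1})^{\xi_2}$ isomorphically onto itself, $\mathrm{Sk}_{A,\lambda}(S_{1,1})^{\xi_1}$ isomorphically onto $\mathrm{Sk}_{A,\lambda}(S_{1,1})^{\xi_3}$, and $\mathrm{Sk}_{A,\lambda}(S_{1,1})^{\xi_3}$ isomorphically onto $\mathrm{Sk}_{A,\lambda}(S_{1,1})^{\xi_1}$; - $\tau_-$ maps $\mathrm{Sk}_{A,\lambda}(S_{1,1})^{\xi_1}$ isomorphically onto itself, $\mathrm{Sk}_{A,\lambda}(S_{1,1})^{\xi_2}$ isomorphically onto $\mathrm{Sk}_{A,\lambda}(S_{1,1})^{\xi_3}$, and $\mathrm{Sk}_{A,\lambda}(S_{1,1})^{\xi_3}$ isomorphically onto $\mathrm{Sk}_{A,\lambda}(S_{1,1})^{\xi_2}$; - $\sigma$ maps $\mathrm{Sk}_{A,\lambda}(S_{1,1})^{\xi_3}$ isomorphically onto itself, $\mathrm{Sk}_{A,\lambda}(S_{1,1})^{\xi_1}$ isomorphically onto $\mathrm{Sk}_{A,\lambda}(S_{1,1})^{\xi_2}$,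 and $\mathrm{Sk}_{A,\lambda}(S_{1,1})^{\xi_2}$ isomorphically onto $\mathrm{Sk}_{A,\lambda}(S_{1,1})^{\xi_1}$.
   Context: $\mathrm{Sk}_{A,\lambda}(S_{1,1})$, the relative skein algebra of the once-punctured torus, is the associative unital $\mathbb{C}[A^{\pm1},\lambda^{\pm1}]$-algebra generated by $\alpha,\beta,\gamma$ with relations $A^{-1}\alpha\beta-A\beta\alpha=(A^{-2}-A^2)\gamma$, $A^{-1}\beta\gamma-A\gamma\beta=(A^{-2}-A^2)\alpha$, $A^{-1}\gamma\alpha-A\alpha\gamma=(A^{-2}-A^2)\beta$, and $A^{-2}\alpha^2+A^2\beta^2+A^{-2}\gamma^2-A^{-1}\alpha\beta\gamma=A^2+A^{-2}+\lambda+\lambda^{-1}$. Let $\gamma_{-1}\in\mathrm{Sk}_{A,\lambda}(S_{1,1})$ be the element satisfying $(A+A^{-1})\gamma_{-1}=\alpha\beta+\beta\alpha-(A+A^{-1})\gamma$; explicitly $\gamma_{-1}=A^{-1}\alpha\beta-A^{-2}\gamma$. The automorphisms are $\mathbb{C}[A^{\pm1},\lambda^{\pm1}]$-linear algebra automorphisms given by $\tau_+:(\alpha,\beta,\gamma)\mapsto(\alpha,\gamma_{-1},\beta)$; $\tau_-:(\alpha,\beta,\gamma)\mapsto(\gamma_{-1},\beta,\alpha)$; $\sigma:(\alpha,\beta,\gamma)\mapsto(\beta,\alpha,\gamma_{-1})$. (Geometrically, $\tau_+$ and $\tau_-$ are Dehn twists around the curves $\alpha$ and $\beta$, and $\sigma=\tau_+\tau_-^{-1}\tau_+$.)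 The involutions are the $\mathbb{C}[A^{\pm1},\lambda^{\pm1}]$-linear algebra automorphisms $\xi_1:(\alpha,\beta,\gamma)\mapsto(-\alpha,\beta,-\gamma)$; $\xi_2:(\alpha,\beta,\gamma)\mapsto(\alpha,-\beta,-\gamma)$; $\xi_3:(\alpha,\beta,\gamma)\mapsto(-\alpha,-\beta,\gamma)$. *)

theory Defs
  imports Complex_Main "HOL-Library.Poly_Mapping" "HOL-Library.Product_Plus"
begin

section \<open>Laurent polynomials and free algebras\<close>

text \<open>The ground ring of complex Laurent polynomials in \<open>A\<close> and \<open>\<lambda>\<close>, as the
  monoid algebra over the additive monoid of exponent pairs.\<close>

type_synonym laurent = "(int \<times> int) \<Rightarrow>\<^sub>0 complex"

definition A_pow :: "int \<Rightarrow> laurent"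
  where "A_pow k = Poly_Mapping.single (k, 0) 1"

definition lam_pow :: "int \<Rightarrow> laurent"
  where "lam_pow k = Poly_Mapping.single (0, k) 1"

lemma A_pow_0 [simp]: "A_pow 0 = 1"
  by (simp add: A_pow_def flip: zero_prod_def)

lemma A_pow_mult [simp]: "A_pow k * A_pow l = A_pow (k + l)"
  by (simp add: A_pow_def mult_single)

lemma lam_pow_0 [simp]: "lam_pow 0 = 1"
  by (simp add: lam_pow_def flip: zero_prod_def)

lemma lam_pow_mult [simp]: "lam_pow k * lam_pow l = lam_pow (k + l)"
  by (simp add: lam_pow_def mult_single)

text \<open>Multiplication of \<open>\<Rightarrow>\<^sub>0\<close> is convolution with respect to \<open>+\<close> on the
  index type.  With concatenation as addition, \<open>'g list \<Rightarrow>\<^sub>0 'c\<close> is therefore the free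
  associative unital \<open>'c\<close>-algebra on \<open>'g\<close>.\<close>

instantiation list :: (type) monoid_add
begin
definition zero_list :: "'a list" where "zero_list = []"
definition plus_list :: "'a list \<Rightarrow> 'a list \<Rightarrow> 'a list" where "plus_list = (@)"
instance by standard (simp_all add: zero_list_def plus_list_def)
end

datatype skein_gen = Gen_alpha | Gen_beta | Gen_gamma

type_synonym free_skein = "skein_gen list \<Rightarrow>\<^sub>0 laurent"

definition free_gen :: "skein_gen \<Rightarrow> free_skein"
  where "free_gen g = Poly_Mapping.single [g] 1"

definition free_scale :: "laurent \<Rightarrow> free_skein \<Rightarrow> free_skein"  (infixr \<open>\<odot>\<^sub>f\<close> 66)
  where "c \<odot>\<^sub>f p = Poly_Mapping.single [] c * p"

subsection \<open>Evaluation homomorphisms\<close>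

definition pm_eval :: "('c::zero \<Rightarrow> 'b) \<Rightarrow> ('m \<Rightarrow> 'b) \<Rightarrow> ('m \<Rightarrow>\<^sub>0 'c) \<Rightarrow> 'b::ring_1"
  where "pm_eval h m p = (\<Sum>w\<in>Poly_Mapping.keys p. h (Poly_Mapping.lookup p w) * m w)"

lemma pm_add_induct [case_names zero single add]:
  assumes "P 0" "\<And>k c. P (Poly_Mapping.single k c)" "\<And>p q. P p \<Longrightarrow> P q \<Longrightarrow> P (p + q)"
  shows "P (p :: 'm \<Rightarrow>\<^sub>0 'c::comm_monoid_add)"
proof (induction p rule: update_induct)
  case const
  show ?case by (fact assms(1))
next
  case (update f a b)
  have "Poly_Mapping.update a b f = f + Poly_Mapping.single a b"
    by (rule poly_mapping_eqI)
      (use update(1) in \<open>auto simp: Poly_Mapping.lookup_update lookup_add lookup_single when_def in_keys_iff\<close>)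
  then show ?case using assms update by simp
qed

lemma pm_eval_single: "h 0 = 0 \<Longrightarrow> pm_eval h m (Poly_Mapping.single k c) = h c * m k"
  by (simp add: pm_eval_def)

lemma pm_eval_add:
  assumes "h 0 = 0" "\<And>a b. h (a + b) = h a + h b"
  shows "pm_eval h m (p + q) = pm_eval h m p + pm_eval h m q"
  unfolding pm_eval_def
  by (rule setsum_keys_plus_distrib) (simp_all add: assms distrib_right)

lemma pm_eval_mult:
  fixes h :: "'c::semiring_0 \<Rightarrow> 'b::ring_1" and m :: "'m::monoid_add \<Rightarrow> 'b"
  assumes h: "h 0 = 0" "\<And>a b. h (a + b) = h a + h b" "\<And>a b. h (a * b) = h a * h b"
    and m: "\<And>k l. m (k + l) = m k * m l"
    and comm: "\<And>c x. h c * x = x * h c"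
  shows "pm_eval h m (p * q) = pm_eval h m p * pm_eval h m q"
proof (induction p rule: pm_add_induct)
  case zero
  show ?case by (simp add: pm_eval_def)
next
  case (single k c)
  show ?case
  proof (induction q rule: pm_add_induct)
    case zero
    show ?case by (simp add: pm_eval_def)
  next
    case (single l d)
    have "h c * h d * (m k * m l) = h c * (h d * m k) * m l" by (simp only: mult.assoc)
    also have "\<dots> = h c * (m k * h d) * m l" by (simp only: comm[of d "m k"])
    finally show ?case
      by (simp add: mult_single pm_eval_single h m mult.assoc)
  next
    case (add p q)
    then show ?case by (simp add: distrib_left pm_eval_add h)
  qed
next
  case (add p q)
  then show ?case by (simp add: distrib_right pm_eval_add h)
qed

definition free_subst :: "(skein_gen \<Rightarrow> free_skein) \<Rightarrow> free_skein \<Rightarrow> free_skein"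
  where "free_subst f = pm_eval (Poly_Mapping.single []) (\<lambda>w. prod_list (map f w))"

lemma single_Nil_1: "Poly_Mapping.single [] 1 = (1 :: 'g list \<Rightarrow>\<^sub>0 'c::zero_neq_one)"
  by (simp flip: zero_list_def)

lemma single_Nil_mult:
  "Poly_Mapping.single [] (c * d) = Poly_Mapping.single [] c * (Poly_Mapping.single [] d :: 'g list \<Rightarrow>\<^sub>0 'c::semiring_0)"
  by (simp add: mult_single plus_list_def)

lemma single_Nil_commute:
  "Poly_Mapping.single [] c * p = p * Poly_Mapping.single [] (c :: 'c::comm_ring_1)"
  by (induction p rule: pm_add_induct)
    (simp_all add: mult_single plus_list_def mult.commute distrib_left distrib_right)

lemma free_subst_add: "free_subst f (p + q) = free_subst f p + free_subst f q"
  unfolding free_subst_def by (rule pm_eval_add) (simp_all add: single_add)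

lemma free_subst_mult: "free_subst f (p * q) = free_subst f p * free_subst f q"
  unfolding free_subst_def
  by (rule pm_eval_mult)
    (simp_all add: single_add single_Nil_mult plus_list_def, rule single_Nil_commute)

lemma free_subst_single: "free_subst f (Poly_Mapping.single w c) = c \<odot>\<^sub>f prod_list (map f w)"
  by (simp add: free_subst_def pm_eval_single free_scale_def)

lemma free_subst_1: "free_subst f 1 = 1"
  using free_subst_single[of f "[]" 1] by (simp add: single_Nil_1 free_scale_def)

lemma free_subst_gen: "free_subst f (free_gen g) = f g"
  by (simp add: free_gen_def free_subst_single single_Nil_1 free_scale_def)

lemma free_subst_scale: "free_subst f (c \<odot>\<^sub>f p) = c \<odot>\<^sub>f free_subst f p"
  by (simp add: free_scale_def free_subst_mult free_subst_single)

lemma free_subst_0: "free_subst f 0 = 0"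
  using free_subst_add[of f 0 0] by simp

lemma free_subst_diff: "free_subst f (p - q) = free_subst f p - free_subst f q"
  using free_subst_add[of f "p - q" q] by (simp add: algebra_simps)


section \<open>The relative skein algebra of the once-punctured torus\<close>

definition two_sided_ideal :: "'a::ring_1 set \<Rightarrow> bool"
  where "two_sided_ideal I \<longleftrightarrow>
    0 \<in> I \<and> (\<forall>x\<in>I. \<forall>y\<in>I. x + y \<in> I) \<and> (\<forall>r. \<forall>x\<in>I. r * x \<in> I \<and> x * r \<in> I)"

definition skein_relators :: "free_skein set"
  where "skein_relators =
    (let a = free_gen Gen_alpha; b = free_gen Gen_beta; c = free_gen Gen_gamma in
      {(A_pow (-1) \<odot>\<^sub>f a * b) - (A_pow 1 \<odot>\<^sub>f b * a) - ((A_pow (-2) - A_pow 2) \<odot>\<^sub>f c),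
       (A_pow (-1) \<odot>\<^sub>f b * c) - (A_pow 1 \<odot>\<^sub>f c * b) - ((A_pow (-2) - A_pow 2) \<odot>\<^sub>f a),
       (A_pow (-1) \<odot>\<^sub>f c * a) - (A_pow 1 \<odot>\<^sub>f a * c) - ((A_pow (-2) - A_pow 2) \<odot>\<^sub>f b),
       (A_pow (-2) \<odot>\<^sub>f a\<^sup>2) + (A_pow 2 \<odot>\<^sub>f b\<^sup>2) + (A_pow (-2) \<odot>\<^sub>f c\<^sup>2) - (A_pow (-1) \<odot>\<^sub>f a * b * c)
         - ((A_pow 2 + A_pow (-2) + lam_pow 1 + lam_pow (-1)) \<odot>\<^sub>f 1)})"

definition skein_ideal :: "free_skein set"
  where "skein_ideal = two_sided_ideal hull skein_relators"

lemma two_sided_ideal_skein_ideal: "two_sided_ideal skein_ideal"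
  unfolding skein_ideal_def by (rule hull_in) (auto simp: two_sided_ideal_def)

lemma skein_ideal_0: "0 \<in> skein_ideal"
  and skein_ideal_add: "x \<in> skein_ideal \<Longrightarrow> y \<in> skein_ideal \<Longrightarrow> x + y \<in> skein_ideal"
  and skein_ideal_mult_left: "x \<in> skein_ideal \<Longrightarrow> r * x \<in> skein_ideal"
  and skein_ideal_mult_right: "x \<in> skein_ideal \<Longrightarrow> x * r \<in> skein_ideal"
  using two_sided_ideal_skein_ideal by (auto simp: two_sided_ideal_def)

lemma skein_ideal_uminus: "x \<in> skein_ideal \<Longrightarrow> - x \<in> skein_ideal"
  using skein_ideal_mult_left[of x "- 1"] by simp

lemma skein_ideal_diff: "x \<in> skein_ideal \<Longrightarrow> y \<in> skein_ideal \<Longrightarrow> x - y \<in> skein_ideal"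
  using skein_ideal_add[of x "- y"] skein_ideal_uminus by simp

text \<open>The next two lemmas show that the quotient is not the zero ring, as the class
  \<open>ring_1\<close> demands: sending the generators to \<open>0\<close>, \<open>A\<close> to \<open>1\<close> and \<open>\<lambda>\<close> to \<open>-1\<close>
  kills all relators.\<close>

lemma skein_ideal_character:
  obtains \<phi> :: "free_skein \<Rightarrow> complex" where "\<phi> 1 = 1" "\<And>p. p \<in> skein_ideal \<Longrightarrow> \<phi> p = 0"
proof -
  define h :: "laurent \<Rightarrow> complex" where "h = pm_eval id (\<lambda>k. (-1) powi (snd k))"
  define \<phi> :: "free_skein \<Rightarrow> complex" where "\<phi> = pm_eval h (\<lambda>w. if w = [] then 1 else 0)"
  have h_add: "h (p + q) = h p + h q" for p q
    unfolding h_def by (rule pm_eval_add) simp_all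
  have h_mult: "h (p * q) = h p * h q" for p q
    unfolding h_def by (rule pm_eval_mult) (simp_all add: power_int_add)
  have h_0: "h 0 = 0" using h_add[of 0 0] by simp
  have h_1: "h 1 = 1"
    by (simp add: h_def pm_eval_def)
  have h_A: "h (A_pow k) = 1" for k
    by (simp add: h_def A_pow_def pm_eval_single)
  have h_lam: "h (lam_pow k) = (-1) powi k" for k
    by (simp add: h_def lam_pow_def pm_eval_single)
  have h_diff: "h (p - q) = h p - h q" for p q
    using h_add[of "p - q" q] by (simp add: algebra_simps)
  have add: "\<phi> (p + q) = \<phi> p + \<phi> q" for p q
    unfolding \<phi>_def by (rule pm_eval_add) (simp_all add: h_0 h_add)
  have mult: "\<phi> (p * q) = \<phi> p * \<phi> q" for p q
    unfolding \<phi>_def by (rule pm_eval_mult) (simp_all add: h_0 h_add h_mult plus_list_def)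
  have diff: "\<phi> (p - q) = \<phi> p - \<phi> q" for p q
    using add[of "p - q" q] by (simp add: algebra_simps)
  have gen: "\<phi> (free_gen g) = 0" for g
    by (simp add: \<phi>_def free_gen_def pm_eval_single h_0)
  have scale: "\<phi> (c \<odot>\<^sub>f p) = h c * \<phi> p" for c p
    unfolding free_scale_def mult by (simp add: \<phi>_def pm_eval_single h_0)
  have one: "\<phi> 1 = 1"
    unfolding single_Nil_1[symmetric] by (simp add: \<phi>_def pm_eval_single h_0 h_1)
  have "\<phi> p = 0" if "p \<in> skein_ideal" for p
  proof (rule hull_induct[OF that[unfolded skein_ideal_def]])
    show "\<phi> p = 0" if "p \<in> skein_relators" for p
      using that
      by (auto simp: skein_relators_def Let_def add diff mult gen scale one
          h_add h_diff h_A h_lam power2_eq_square)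
    have "\<phi> 0 = 0" using add[of 0 0] by simp
    then show "two_sided_ideal {p. \<phi> p = 0}"
      by (auto simp: two_sided_ideal_def add mult)
  qed
  with one show thesis by (rule that)
qed

lemma one_notin_skein_ideal: "1 \<notin> skein_ideal"
  using skein_ideal_character by (metis zero_neq_one)

quotient_type skein = free_skein / "\<lambda>x y. x - y \<in> skein_ideal"
  morphisms rep_skein abs_skein
proof (rule equivpI)
  show "reflp (\<lambda>x y. x - y \<in> skein_ideal)"
    by (rule reflpI) (simp add: skein_ideal_0)
  show "symp (\<lambda>x y. x - y \<in> skein_ideal)"
    by (rule sympI) (drule skein_ideal_uminus, simp)
  show "transp (\<lambda>x y. x - y \<in> skein_ideal)"
    by (rule transpI) (drule (1) skein_ideal_add, simp)
qed

instantiation skein :: ring_1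
begin

lift_definition zero_skein :: skein is 0 .
lift_definition one_skein :: skein is 1 .
lift_definition plus_skein :: "skein \<Rightarrow> skein \<Rightarrow> skein" is "(+)"
  unfolding add_diff_add by (rule skein_ideal_add)
lift_definition minus_skein :: "skein \<Rightarrow> skein \<Rightarrow> skein" is "(-)"
proof -
  fix a b c d :: free_skein
  assume "a - b \<in> skein_ideal" "c - d \<in> skein_ideal"
  then have "(a - b) - (c - d) \<in> skein_ideal" by (rule skein_ideal_diff)
  then show "a - c - (b - d) \<in> skein_ideal" by (simp add: algebra_simps)
qed
lift_definition uminus_skein :: "skein \<Rightarrow> skein" is uminus
  unfolding minus_diff_minus by (rule skein_ideal_uminus)
lift_definition times_skein :: "skein \<Rightarrow> skein \<Rightarrow> skein" is "(*)"
proof -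
  fix a b c d :: free_skein
  assume "a - b \<in> skein_ideal" "c - d \<in> skein_ideal"
  then have "(a - b) * c + b * (c - d) \<in> skein_ideal"
    by (intro skein_ideal_add skein_ideal_mult_left skein_ideal_mult_right)
  then show "a * c - b * d \<in> skein_ideal" by (simp add: algebra_simps)
qed

instance
proof
  show "(0::skein) \<noteq> 1"
    by transfer (use one_notin_skein_ideal skein_ideal_uminus[of "- 1"] in auto)
qed (transfer; simp add: algebra_simps skein_ideal_0)+

end

lift_definition skein_scale :: "laurent \<Rightarrow> skein \<Rightarrow> skein"  (infixr \<open>\<odot>\<close> 66) is free_scale
  by (simp add: free_scale_def skein_ideal_mult_left flip: right_diff_distrib)

lemma skein_scale_right_distrib: "c \<odot> (x + y) = (c \<odot> x) + (c \<odot> y)"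
  and skein_scale_left_distrib: "(c + d) \<odot> x = (c \<odot> x) + (d \<odot> x)"
  and skein_scale_scale: "c \<odot> d \<odot> x = (c * d) \<odot> x"
  and skein_scale_one: "1 \<odot> x = x"
  by (transfer; simp add: free_scale_def algebra_simps single_add single_Nil_mult single_Nil_1
      skein_ideal_0)+

interpretation skein: module skein_scale
  by standard (fact skein_scale_right_distrib skein_scale_left_distrib
      skein_scale_scale skein_scale_one)+

lemma skein_scale_mult_left: "(c \<odot> x) * y = (c \<odot> x * y)"
  by transfer (simp add: free_scale_def mult.assoc skein_ideal_0)

lemma skein_scale_mult_right: "x * (c \<odot> y) = (c \<odot> x * y)"
  by transfer (simp add: free_scale_def skein_ideal_0 flip: mult.assoc,
      simp add: single_Nil_commute skein_ideal_0)

lift_definition s_alpha :: skein is "free_gen Gen_alpha" .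
lift_definition s_beta :: skein is "free_gen Gen_beta" .
lift_definition s_gamma :: skein is "free_gen Gen_gamma" .

definition skein_relations :: "skein \<Rightarrow> skein \<Rightarrow> skein \<Rightarrow> bool"
  where "skein_relations a b c \<longleftrightarrow>
    (A_pow (-1) \<odot> a * b) - (A_pow 1 \<odot> b * a) = ((A_pow (-2) - A_pow 2) \<odot> c) \<and>
    (A_pow (-1) \<odot> b * c) - (A_pow 1 \<odot> c * b) = ((A_pow (-2) - A_pow 2) \<odot> a) \<and>
    (A_pow (-1) \<odot> c * a) - (A_pow 1 \<odot> a * c) = ((A_pow (-2) - A_pow 2) \<odot> b) \<and>
    (A_pow (-2) \<odot> a\<^sup>2) + (A_pow 2 \<odot> b\<^sup>2) + (A_pow (-2) \<odot> c\<^sup>2) - (A_pow (-1) \<odot> a * b * c)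
      = ((A_pow 2 + A_pow (-2) + lam_pow 1 + lam_pow (-1)) \<odot> 1)"

lemma abs_skein_eq_0_iff: "abs_skein p = 0 \<longleftrightarrow> p \<in> skein_ideal"
  by (simp add: zero_skein_def skein.abs_eq_iff)

lemmas abs_skein_hom =
  plus_skein.abs_eq[symmetric] minus_skein.abs_eq[symmetric] times_skein.abs_eq[symmetric]
  skein_scale.abs_eq[symmetric] one_skein.abs_eq[symmetric]

lemma skein_relations_iff:
  "skein_relations (abs_skein a) (abs_skein b) (abs_skein c) \<longleftrightarrow>
    (\<forall>r\<in>skein_relators. free_subst (case_skein_gen a b c) r \<in> skein_ideal)"
  by (simp add: skein_relators_def skein_relations_def Let_def free_subst_add free_subst_diff
      free_subst_mult free_subst_scale free_subst_gen free_subst_1 power2_eq_square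
      abs_skein_hom flip: abs_skein_eq_0_iff)

lemma free_subst_free_gen: "free_subst (case_skein_gen (free_gen Gen_alpha) (free_gen Gen_beta)
  (free_gen Gen_gamma)) p = p"
proof (induction p rule: pm_add_induct)
  case (single w c)
  have "prod_list (map (case_skein_gen (free_gen Gen_alpha) (free_gen Gen_beta)
    (free_gen Gen_gamma)) w) = Poly_Mapping.single w 1"
    by (induction w)
      (auto simp: single_Nil_1 free_gen_def mult_single plus_list_def split: skein_gen.split)
  then show ?case
    by (simp add: free_subst_single free_scale_def mult_single plus_list_def)
qed (simp_all add: free_subst_0 free_subst_add)

lemma skein_relations_gens: "skein_relations s_alpha s_beta s_gamma"
  unfolding s_alpha_def s_beta_def s_gamma_def skein_relations_iff
  by (simp add: free_subst_free_gen skein_ideal_def hull_inc)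

text \<open>Substituting for the generators respects the quotient if the defining relations hold
  for the images.\<close>

lemma free_subst_respects:
  assumes "skein_relations (abs_skein a) (abs_skein b) (abs_skein c)" "x - y \<in> skein_ideal"
  shows "free_subst (case_skein_gen a b c) x - free_subst (case_skein_gen a b c) y \<in> skein_ideal"
proof -
  let ?f = "free_subst (case_skein_gen a b c)"
  have "x - y \<in> two_sided_ideal hull skein_relators"
    using assms(2) by (simp add: skein_ideal_def)
  then have "?f (x - y) \<in> skein_ideal"
  proof (rule hull_induct)
    show "?f p \<in> skein_ideal" if "p \<in> skein_relators" for p
      using assms(1) that by (simp add: skein_relations_iff)
    show "two_sided_ideal {p. ?f p \<in> skein_ideal}"
      by (auto simp: two_sided_ideal_def free_subst_0 free_subst_add free_subst_mult
          skein_ideal_0 skein_ideal_add skein_ideal_mult_left skein_ideal_mult_right)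
  qed
  then show ?thesis by (simp add: free_subst_diff)
qed

subsection \<open>The element \<open>\<gamma>\<^sub>-\<^sub>1\<close>\<close>

definition free_gamma_m1 :: free_skein
  where "free_gamma_m1 =
    (A_pow (-1) \<odot>\<^sub>f free_gen Gen_alpha * free_gen Gen_beta) - (A_pow (-2) \<odot>\<^sub>f free_gen Gen_gamma)"

lift_definition s_gamma_m1 :: skein is free_gamma_m1 .

lemma s_gamma_m1_eq: "s_gamma_m1 = (A_pow (-1) \<odot> s_alpha * s_beta) - (A_pow (-2) \<odot> s_gamma)"
  by (simp add: s_gamma_m1_def free_gamma_m1_def abs_skein_hom s_alpha_def s_beta_def s_gamma_def)

lemma skein_relations_mutate:
  assumes "skein_relations a b c" and d: "d = (A_pow (-1) \<odot> a * b) - (A_pow (-2) \<odot> c)"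
  shows "skein_relations a d b" "skein_relations d b a" "skein_relations b a d"
proof -
  let ?K = "A_pow (-2) - A_pow 2"
  let ?W = "(A_pow 2 + A_pow (-2) + lam_pow 1 + lam_pow (-1)) \<odot> 1"
  note S = skein.scale_right_diff_distrib skein.scale_left_diff_distrib skein_scale_right_distrib
    skein_scale_left_distrib skein_scale_scale skein_scale_mult_left skein_scale_mult_right
    left_diff_distrib right_diff_distrib distrib_left distrib_right mult.assoc
    power2_eq_square skein_scale_one
  from assms(1) have R1: "(A_pow (-1) \<odot> a * b) - (A_pow 1 \<odot> b * a) = (?K \<odot> c)"
    and R2: "(A_pow (-1) \<odot> b * c) - (A_pow 1 \<odot> c * b) = (?K \<odot> a)"
    and R3: "(A_pow (-1) \<odot> c * a) - (A_pow 1 \<odot> a * c) = (?K \<odot> b)"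
    and R4: "(A_pow (-2) \<odot> a\<^sup>2) + (A_pow 2 \<odot> b\<^sup>2) + (A_pow (-2) \<odot> c\<^sup>2)
      - (A_pow (-1) \<odot> a * b * c) = ?W"
    by (simp_all add: skein_relations_def)
  have d': "d = (A_pow 1 \<odot> b * a) - (A_pow 2 \<odot> c)"
    using R1 by (simp add: d skein.scale_left_diff_distrib algebra_simps)
  have x1: "(A_pow (-1) \<odot> a * d) = a * b * a - (A_pow 1 \<odot> a * c)" by (simp add: d' S)
  have x2: "(A_pow 1 \<odot> d * a) = a * b * a - (A_pow (-1) \<odot> c * a)" by (simp add: d S)
  have F1: "(A_pow (-1) \<odot> a * d) - (A_pow 1 \<odot> d * a) = (?K \<odot> b)"
    unfolding x1 x2 R3[symmetric] by (simp add: algebra_simps)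
  have y1: "(A_pow (-1) \<odot> d * b) = b * a * b - (A_pow 1 \<odot> c * b)" by (simp add: d' S)
  have y2: "(A_pow 1 \<odot> b * d) = b * a * b - (A_pow (-1) \<odot> b * c)" by (simp add: d S)
  have F2: "(A_pow (-1) \<odot> d * b) - (A_pow 1 \<odot> b * d) = (?K \<odot> a)"
    unfolding y1 y2 R2[symmetric] by (simp add: algebra_simps)
  have ba: "(A_pow (-1) \<odot> b * a) = (A_pow (-2) \<odot> d) + c" by (simp add: d' S)
  have ab: "(A_pow 1 \<odot> a * b) = (A_pow 2 \<odot> d) + c" by (simp add: d S)
  have F3: "(A_pow (-1) \<odot> b * a) - (A_pow 1 \<odot> a * b) = (?K \<odot> d)"
    by (simp add: ba ab skein.scale_left_diff_distrib)
  have dc: "d * c = (A_pow (-1) \<odot> a * b * c) - (A_pow (-2) \<odot> c\<^sup>2)" by (simp add: d S)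
  have R4': "(A_pow (-2) \<odot> a\<^sup>2) + (A_pow 2 \<odot> b\<^sup>2) - d * c = ?W"
    using R4 by (simp add: dc algebra_simps)

  have "(A_pow (-1) \<odot> a * d * b) = (A_pow (-1) \<odot> a * d) * b" by (simp add: S)
  also have "(A_pow (-1) \<odot> a * d) = (A_pow 1 \<odot> d * a) + (?K \<odot> b)"
    using F1 by (simp add: algebra_simps)
  also have "((A_pow 1 \<odot> d * a) + (?K \<odot> b)) * b = d * (A_pow 1 \<odot> a * b) + (?K \<odot> b\<^sup>2)" by (simp add: S)
  also have "\<dots> = (A_pow 2 \<odot> d\<^sup>2) + d * c + (?K \<odot> b\<^sup>2)" unfolding ab by (simp add: S)
  finally have adb: "(A_pow (-1) \<odot> a * d * b) = (A_pow 2 \<odot> d\<^sup>2) + d * c + (?K \<odot> b\<^sup>2)" .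
  have "(A_pow (-2) \<odot> a\<^sup>2) + (A_pow 2 \<odot> d\<^sup>2) + (A_pow (-2) \<odot> b\<^sup>2)
      - (A_pow (-1) \<odot> a * d * b) = ?W"
    unfolding adb R4'[symmetric] by (simp add: skein.scale_left_diff_distrib algebra_simps)
  then show "skein_relations a d b" using F1 F2 F3 by (simp add: skein_relations_def)

  have "(A_pow (-1) \<odot> d * b * a) = d * (A_pow (-1) \<odot> b * a)" by (simp add: S)
  also have "\<dots> = (A_pow (-2) \<odot> d\<^sup>2) + d * c" unfolding ba by (simp add: S)
  finally have dba: "(A_pow (-1) \<odot> d * b * a) = (A_pow (-2) \<odot> d\<^sup>2) + d * c" .
  have "(A_pow (-2) \<odot> d\<^sup>2) + (A_pow 2 \<odot> b\<^sup>2) + (A_pow (-2) \<odot> a\<^sup>2)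
      - (A_pow (-1) \<odot> d * b * a) = ?W"
    unfolding dba R4'[symmetric] by (simp add: skein.scale_left_diff_distrib algebra_simps)
  then show "skein_relations d b a" using F1 F2 F3 by (simp add: skein_relations_def)

  have "c * d = (A_pow (-1) \<odot> c * a) * b - (A_pow (-2) \<odot> c\<^sup>2)" by (simp add: d S)
  also have "(A_pow (-1) \<odot> c * a) = (A_pow 1 \<odot> a * c) + (?K \<odot> b)"
    using R3 by (simp add: algebra_simps)
  also have "((A_pow 1 \<odot> a * c) + (?K \<odot> b)) * b = a * (A_pow 1 \<odot> c * b) + (?K \<odot> b\<^sup>2)"
    by (simp add: S)
  also have "(A_pow 1 \<odot> c * b) = (A_pow (-1) \<odot> b * c) - (?K \<odot> a)"
    using R2 by (simp add: algebra_simps)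
  also have "a * ((A_pow (-1) \<odot> b * c) - (?K \<odot> a)) = (A_pow (-1) \<odot> a * b * c) - (?K \<odot> a\<^sup>2)"
    by (simp add: S)
  finally have cd: "c * d = d * c - (?K \<odot> a\<^sup>2) + (?K \<odot> b\<^sup>2)"
    by (simp add: dc algebra_simps)
  have "(A_pow (-1) \<odot> b * a * d) = (A_pow (-1) \<odot> b * a) * d" by (simp add: S)
  also have "\<dots> = (A_pow (-2) \<odot> d\<^sup>2) + c * d" unfolding ba by (simp add: S)
  finally have bad: "(A_pow (-1) \<odot> b * a * d) = (A_pow (-2) \<odot> d\<^sup>2) + c * d" .
  have "(A_pow (-2) \<odot> b\<^sup>2) + (A_pow 2 \<odot> a\<^sup>2) + (A_pow (-2) \<odot> d\<^sup>2)
      - (A_pow (-1) \<odot> b * a * d) = ?W"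
    unfolding bad cd R4'[symmetric] by (simp add: skein.scale_left_diff_distrib algebra_simps)
  then show "skein_relations b a d" using F1 F2 F3 by (simp add: skein_relations_def)
qed

lemma skein_relations_signs:
  assumes "skein_relations a b c"
  shows "skein_relations (- a) b (- c)" "skein_relations a (- b) (- c)"
    "skein_relations (- a) (- b) c"
  using assms by (simp_all add: skein_relations_def algebra_simps)

lemma s_gamma_m1_char:
  "((A_pow 1 + A_pow (-1)) \<odot> s_gamma_m1)
    = s_alpha * s_beta + s_beta * s_alpha - ((A_pow 1 + A_pow (-1)) \<odot> s_gamma)"
proof -
  have R1: "(A_pow (-1) \<odot> s_alpha * s_beta) - (A_pow 1 \<odot> s_beta * s_alpha)
      = ((A_pow (-2) - A_pow 2) \<odot> s_gamma)"
    using skein_relations_gens by (simp add: skein_relations_def)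
  have d': "s_gamma_m1 = (A_pow 1 \<odot> s_beta * s_alpha) - (A_pow 2 \<odot> s_gamma)"
    using R1 by (simp add: s_gamma_m1_eq skein.scale_left_diff_distrib algebra_simps)
  have e1: "(A_pow (-1) \<odot> s_gamma_m1) = s_beta * s_alpha - (A_pow 1 \<odot> s_gamma)"
    unfolding d' by (simp add: skein.scale_right_diff_distrib skein_scale_scale skein_scale_one)
  have e2: "(A_pow 1 \<odot> s_gamma_m1) = s_alpha * s_beta - (A_pow (-1) \<odot> s_gamma)"
    by (simp add: s_gamma_m1_eq skein.scale_right_diff_distrib skein_scale_scale skein_scale_one)
  show ?thesis
    unfolding skein_scale_left_distrib e1 e2 by (simp add: algebra_simps)
qed

subsection \<open>The automorphisms and the involutions\<close>

lemma abs_skein_gens: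
  "abs_skein (free_gen Gen_alpha) = s_alpha" "abs_skein (free_gen Gen_beta) = s_beta"
  "abs_skein (free_gen Gen_gamma) = s_gamma" "abs_skein free_gamma_m1 = s_gamma_m1"
  by (simp_all add: s_alpha_def s_beta_def s_gamma_def s_gamma_m1_def)

lemmas skein_relations_images =
  skein_relations_mutate[OF skein_relations_gens s_gamma_m1_eq]
  skein_relations_signs[OF skein_relations_gens]

lift_definition tau_plus :: "skein \<Rightarrow> skein"
  is "free_subst (case_skein_gen (free_gen Gen_alpha) free_gamma_m1 (free_gen Gen_beta))"
  by (rule free_subst_respects) (simp_all add: abs_skein_gens skein_relations_images)

lift_definition tau_minus :: "skein \<Rightarrow> skein"
  is "free_subst (case_skein_gen free_gamma_m1 (free_gen Gen_beta) (free_gen Gen_alpha))"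
  by (rule free_subst_respects) (simp_all add: abs_skein_gens skein_relations_images)

lift_definition sigma :: "skein \<Rightarrow> skein"
  is "free_subst (case_skein_gen (free_gen Gen_beta) (free_gen Gen_alpha) free_gamma_m1)"
  by (rule free_subst_respects) (simp_all add: abs_skein_gens skein_relations_images)

lift_definition xi1 :: "skein \<Rightarrow> skein"
  is "free_subst (case_skein_gen (- free_gen Gen_alpha) (free_gen Gen_beta) (- free_gen Gen_gamma))"
  by (rule free_subst_respects)
    (simp_all add: abs_skein_gens skein_relations_images flip: uminus_skein.abs_eq)

lift_definition xi2 :: "skein \<Rightarrow> skein"
  is "free_subst (case_skein_gen (free_gen Gen_alpha) (- free_gen Gen_beta) (- free_gen Gen_gamma))"
  by (rule free_subst_respects)
    (simp_all add: abs_skein_gens skein_relations_images flip: uminus_skein.abs_eq)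

lift_definition xi3 :: "skein \<Rightarrow> skein"
  is "free_subst (case_skein_gen (- free_gen Gen_alpha) (- free_gen Gen_beta) (free_gen Gen_gamma))"
  by (rule free_subst_respects)
    (simp_all add: abs_skein_gens skein_relations_images flip: uminus_skein.abs_eq)

lemmas skein_map_defs =
  tau_plus.abs_eq tau_minus.abs_eq sigma.abs_eq xi1.abs_eq xi2.abs_eq xi3.abs_eq

lemma skein_map_gens [simp]:
  "tau_plus s_alpha = s_alpha" "tau_plus s_beta = s_gamma_m1" "tau_plus s_gamma = s_beta"
  "tau_minus s_alpha = s_gamma_m1" "tau_minus s_beta = s_beta" "tau_minus s_gamma = s_alpha"
  "sigma s_alpha = s_beta" "sigma s_beta = s_alpha" "sigma s_gamma = s_gamma_m1"
  "xi1 s_alpha = - s_alpha" "xi1 s_beta = s_beta" "xi1 s_gamma = - s_gamma"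
  "xi2 s_alpha = s_alpha" "xi2 s_beta = - s_beta" "xi2 s_gamma = - s_gamma"
  "xi3 s_alpha = - s_alpha" "xi3 s_beta = - s_beta" "xi3 s_gamma = s_gamma"
  by (simp_all add: skein_map_defs free_subst_gen s_alpha_def s_beta_def s_gamma_def
      s_gamma_m1_def uminus_skein.abs_eq)

definition skein_hom_on :: "skein set \<Rightarrow> (skein \<Rightarrow> skein) \<Rightarrow> bool"
  where "skein_hom_on S f \<longleftrightarrow> f 1 = 1 \<and>
    (\<forall>x\<in>S. \<forall>y\<in>S. f (x + y) = f x + f y \<and> f (x * y) = f x * f y) \<and>
    (\<forall>c. \<forall>x\<in>S. f (c \<odot> x) = (c \<odot> f x))"

definition skein_subalgebra :: "skein set \<Rightarrow> bool"
  where "skein_subalgebra S \<longleftrightarrow> 1 \<in> S \<and>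
    (\<forall>x\<in>S. \<forall>y\<in>S. x + y \<in> S \<and> x * y \<in> S) \<and> (\<forall>c. \<forall>x\<in>S. (c \<odot> x) \<in> S)"

definition skein_iso_on :: "(skein \<Rightarrow> skein) \<Rightarrow> skein set \<Rightarrow> skein set \<Rightarrow> bool"
  where "skein_iso_on f S T \<longleftrightarrow>
    skein_subalgebra S \<and> skein_subalgebra T \<and> skein_hom_on S f \<and> bij_betw f S T"

definition skein_invariants :: "(skein \<Rightarrow> skein) \<Rightarrow> skein set"
  where "skein_invariants f = {x. f x = x}"

lemma abs_skein_cases: obtains p where "x = abs_skein p"
  using Quotient_abs_rep[OF Quotient_skein, of x] by metis

lemma skein_hom_free_subst:
  assumes f: "\<And>p. f (abs_skein p) = abs_skein (free_subst g p)"
  shows "skein_hom_on UNIV f"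
  unfolding skein_hom_on_def
proof (intro conjI ballI allI)
  show "f 1 = 1" by (simp add: one_skein_def f free_subst_1)
  fix x y c
  obtain p where p: "x = abs_skein p" by (rule abs_skein_cases)
  obtain q where q: "y = abs_skein q" by (rule abs_skein_cases)
  show "f (x + y) = f x + f y"
    by (simp only: p q f free_subst_add plus_skein.abs_eq)
  show "f (x * y) = f x * f y"
    by (simp only: p q f free_subst_mult times_skein.abs_eq)
  show "f (c \<odot> x) = (c \<odot> f x)"
    by (simp only: p f free_subst_scale skein_scale.abs_eq)
qed

lemma skein_map_homs:
  "skein_hom_on UNIV tau_plus" "skein_hom_on UNIV tau_minus" "skein_hom_on UNIV sigma"
  "skein_hom_on UNIV xi1" "skein_hom_on UNIV xi2" "skein_hom_on UNIV xi3"
  by (rule skein_hom_free_subst, rule skein_map_defs)+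

lemma skein_hom_eqI:
  assumes "skein_hom_on UNIV f" "skein_hom_on UNIV g"
    and "f s_alpha = g s_alpha" "f s_beta = g s_beta" "f s_gamma = g s_gamma"
  shows "f = g"
proof
  fix x
  have h: "h 0 = 0" if "skein_hom_on UNIV h" for h
  proof -
    have "h (0 + 0) = h 0 + h 0" using that unfolding skein_hom_on_def by blast
    then show ?thesis by simp
  qed
  obtain p where x: "x = abs_skein p" by (rule abs_skein_cases)
  have "f (abs_skein p) = g (abs_skein p)"
  proof (induction p rule: pm_add_induct)
    case zero
    show ?case using h[OF assms(1)] h[OF assms(2)] by (simp flip: zero_skein_def)
  next
    case (add p q)
    then show ?case using assms(1,2)
      by (simp add: skein_hom_on_def flip: plus_skein.abs_eq)
  next
    case (single w c)
    have 1: "f (abs_skein (Poly_Mapping.single w 1)) = g (abs_skein (Poly_Mapping.single w 1))"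
    proof (induction w)
      case Nil
      then show ?case
        using assms(1,2) by (simp add: single_Nil_1 skein_hom_on_def flip: one_skein_def)
    next
      case (Cons a w)
      have "Poly_Mapping.single (a # w) 1 = free_gen a * Poly_Mapping.single w 1"
        by (simp add: free_gen_def mult_single plus_list_def)
      moreover have "f (abs_skein (free_gen a)) = g (abs_skein (free_gen a))"
        by (cases a) (simp_all add: abs_skein_gens assms)
      ultimately show ?case
        using assms(1,2) Cons by (simp add: skein_hom_on_def flip: times_skein.abs_eq)
    qed
    have "Poly_Mapping.single w c = (c \<odot>\<^sub>f Poly_Mapping.single w 1)"
      by (simp add: free_scale_def mult_single plus_list_def)
    then show ?case
      using assms(1,2) 1 by (simp add: skein_hom_on_def flip: skein_scale.abs_eq)
  qed
  then show "f x = g x" by (simp add: x)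
qed

lemma skein_hom_comp:
  "skein_hom_on UNIV f \<Longrightarrow> skein_hom_on UNIV g \<Longrightarrow> skein_hom_on UNIV (f \<circ> g)"
  by (simp add: skein_hom_on_def)

lemma skein_hom_id: "skein_hom_on UNIV id"
  by (simp add: skein_hom_on_def)

lemma sigma_s_gamma_m1 [simp]: "sigma s_gamma_m1 = s_gamma"
proof -
  have add: "sigma (x + y) = sigma x + sigma y"
    and mult: "sigma (x * y) = sigma x * sigma y"
    and scale: "sigma (c \<odot> x) = (c \<odot> sigma x)" for x y c
    using skein_map_homs(3) unfolding skein_hom_on_def by blast+
  have R1: "(A_pow (-1) \<odot> s_alpha * s_beta) - (A_pow 1 \<odot> s_beta * s_alpha)
      = ((A_pow (-2) - A_pow 2) \<odot> s_gamma)"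
    using skein_relations_gens by (simp add: skein_relations_def)
  have d': "s_gamma_m1 = (A_pow 1 \<odot> s_beta * s_alpha) - (A_pow 2 \<odot> s_gamma)"
    using R1 by (simp add: s_gamma_m1_eq skein.scale_left_diff_distrib algebra_simps)
  have "sigma s_gamma_m1 + (A_pow (-2) \<odot> sigma s_gamma) = (A_pow (-1) \<odot> sigma (s_alpha * s_beta))"
    by (simp only: s_gamma_m1_eq diff_add_cancel flip: add scale)
  then have "sigma s_gamma_m1 = (A_pow (-1) \<odot> s_beta * s_alpha) - (A_pow (-2) \<odot> s_gamma_m1)"
    by (simp add: mult algebra_simps)
  also have "(A_pow (-2) \<odot> s_gamma_m1) = (A_pow (-1) \<odot> s_beta * s_alpha) - s_gamma"
    unfolding d' by (simp add: skein.scale_right_diff_distrib skein_scale_scale skein_scale_one)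
  finally show ?thesis by simp
qed

lemma sigma_involution: "sigma \<circ> sigma = id"
  by (rule skein_hom_eqI) (simp_all add: skein_hom_comp skein_hom_id skein_map_homs)

lemma sigma_tau_plus_cubed: "sigma \<circ> tau_plus \<circ> sigma \<circ> tau_plus \<circ> sigma \<circ> tau_plus = id"
  by (rule skein_hom_eqI) (simp_all add: skein_hom_comp skein_hom_id skein_map_homs)

lemma sigma_tau_minus_cubed: "sigma \<circ> tau_minus \<circ> sigma \<circ> tau_minus \<circ> sigma \<circ> tau_minus = id"
  by (rule skein_hom_eqI) (simp_all add: skein_hom_comp skein_hom_id skein_map_homs)

lemma xi_involution: "xi1 \<circ> xi1 = id" "xi2 \<circ> xi2 = id" "xi3 \<circ> xi3 = id"
proof -
  have neg: "h (- x) = - h x" if "skein_hom_on UNIV h" for h x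
  proof -
    have "h (x + - x) = h x + h (- x)" "h (0 + 0) = h 0 + h 0"
      using that unfolding skein_hom_on_def by blast+
    then show ?thesis by (simp add: minus_unique)
  qed
  note neg = neg[OF skein_map_homs(4)] neg[OF skein_map_homs(5)] neg[OF skein_map_homs(6)]
  show "xi1 \<circ> xi1 = id" "xi2 \<circ> xi2 = id" "xi3 \<circ> xi3 = id"
    by (rule skein_hom_eqI; simp add: skein_hom_comp skein_hom_id skein_map_homs neg)+
qed

lemma bij_sigma: "bij sigma"
  using sigma_involution by (rule o_bij) (rule sigma_involution)

lemma bij_of_sigma_cubed:
  assumes "sigma \<circ> f \<circ> sigma \<circ> f \<circ> sigma \<circ> f = id"
  shows "bij f" "inv f = sigma \<circ> f \<circ> sigma \<circ> f \<circ> sigma"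
proof -
  let ?g = "sigma \<circ> f \<circ> sigma \<circ> f \<circ> sigma"
  have 1: "?g (f x) = x" for x using fun_cong[OF assms, of x] by simp
  have 2: "f (?g y) = y" for y
    using fun_cong[OF assms, of "sigma y"] fun_cong[OF sigma_involution]
    by (simp add: o_def) metis
  show "bij f" by (rule o_bij[of ?g]) (use 1 2 in \<open>auto simp: fun_eq_iff\<close>)
  show "inv f = ?g" by (rule inv_unique_comp) (use 1 2 in \<open>auto simp: fun_eq_iff\<close>)
qed

lemma bij_skein_maps:
  "bij tau_plus" "bij tau_minus" "bij sigma" "bij xi1" "bij xi2" "bij xi3"
  using bij_of_sigma_cubed(1)[OF sigma_tau_plus_cubed]
    bij_of_sigma_cubed(1)[OF sigma_tau_minus_cubed] bij_sigma xi_involution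
  by (auto intro: o_bij)

lemma sigma_eq: "sigma = tau_plus \<circ> inv tau_minus \<circ> tau_plus"
  unfolding bij_of_sigma_cubed(2)[OF sigma_tau_minus_cubed]
  by (rule skein_hom_eqI) (simp_all add: skein_hom_comp skein_map_homs)

end

theory Submission
  imports Defs
begin

text \<open>If a bijective algebra endomorphism \<open>f\<close> intertwines two endomorphisms, \<open>f \<circ> u = v \<circ> f\<close>,
  then \<open>u x = x\<close> holds exactly when \<open>v (f x) = f x\<close>, so \<open>f\<close> restricts to an isomorphism from the
  invariants of \<open>u\<close> onto those of \<open>v\<close> (\<open>skein_iso_on_invariants\<close>).  The twists and \<open>\<sigma>\<close> are
  bijective, so it remains to find the involution \<open>v\<close> that belongs to each \<open>u = \<xi>\<^sub>i\<close>
  (\<open>skein_map_xi_intertwine\<close>).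

  The answer comes from homology modulo \<open>2\<close>: \<open>\<alpha>\<close> and \<open>\<beta>\<close> are the two basis classes of the torus,
  and \<open>\<gamma>\<close> and \<open>\<gamma>\<^sub>-\<^sub>1\<close> both lie in the class \<open>\<alpha> + \<beta>\<close>.  The involutions are the three nontrivial sign
  characters of this grading; each of them is determined by the one nonzero class on which it is
  trivial, namely \<open>\<beta>\<close> for \<open>\<xi>\<^sub>1\<close>, \<open>\<alpha>\<close> for \<open>\<xi>\<^sub>2\<close> and \<open>\<alpha> + \<beta>\<close> for \<open>\<xi>\<^sub>3\<close>.  Since \<open>\<tau>\<^sub>+\<close> fixes the class \<open>\<alpha>\<close>
  and exchanges the other two, it commutes with \<open>\<xi>\<^sub>2\<close> and exchanges \<open>\<xi>\<^sub>1\<close> with \<open>\<xi>\<^sub>3\<close>; likewise \<open>\<tau>\<^sub>-\<close>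
  fixes the class \<open>\<beta>\<close> and \<open>\<sigma>\<close> the class \<open>\<alpha> + \<beta>\<close>.\<close>

lemma skein_hom_uminus:
  assumes "skein_hom_on UNIV f"
  shows "f (- x) = - f x"
proof -
  have add: "f (y + z) = f y + f z" for y z
    using assms unfolding skein_hom_on_def by blast
  have "f 0 = 0" using add[of 0 0] by simp
  then show ?thesis using add[of x "- x"] by (simp add: minus_unique)
qed

lemma skein_subalgebra_invariants:
  assumes "skein_hom_on UNIV f"
  shows "skein_subalgebra (skein_invariants f)"
  using assms by (simp add: skein_hom_on_def skein_subalgebra_def skein_invariants_def)

text \<open>The intertwining relation makes \<open>f x\<close> invariant whenever \<open>x\<close> is.  Conversely, injectivity of
  \<open>f\<close> shows that the preimage of an invariant element is invariant, so every invariant of \<open>v\<close> is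
  attained.\<close>

lemma skein_iso_on_invariants:
  assumes f: "skein_hom_on UNIV f" "bij f"
    and u: "skein_hom_on UNIV u" and v: "skein_hom_on UNIV v"
    and intertwine: "f \<circ> u = v \<circ> f"
  shows "skein_iso_on f (skein_invariants u) (skein_invariants v)"
proof -
  have fixed_iff: "v (f x) = f x \<longleftrightarrow> u x = x" for x
    using fun_cong[OF intertwine, of x] bij_is_inj[OF f(2)] by (auto simp: inj_eq dest: sym)
  have "f ` skein_invariants u = skein_invariants v"
  proof (intro equalityI subsetI)
    fix y assume "y \<in> skein_invariants v"
    moreover obtain x where "y = f x" using bij_is_surj[OF f(2)] by (rule surjE)
    ultimately show "y \<in> f ` skein_invariants u" by (simp add: skein_invariants_def fixed_iff)
  qed (auto simp: skein_invariants_def fixed_iff)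
  then have "bij_betw f (skein_invariants u) (skein_invariants v)"
    using bij_is_inj[OF f(2)] by (auto simp: bij_betw_def intro: inj_on_subset)
  then show ?thesis
    using f(1) u v
    by (simp add: skein_iso_on_def skein_subalgebra_invariants) (simp add: skein_hom_on_def)
qed

text \<open>Each \<open>\<xi>\<^sub>i\<close> multiplies \<open>\<gamma>\<close> by the product of its signs on \<open>\<alpha>\<close> and \<open>\<beta>\<close>, so both summands of
  \<open>\<gamma>\<^sub>-\<^sub>1 = A\<^sup>-\<^sup>1 \<alpha>\<beta> - A\<^sup>-\<^sup>2 \<gamma>\<close> change by that sign.\<close>

lemma xi_s_gamma_m1:
  "xi1 s_gamma_m1 = - s_gamma_m1" "xi2 s_gamma_m1 = - s_gamma_m1" "xi3 s_gamma_m1 = s_gamma_m1"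
proof -
  have expand: "f s_gamma_m1 =
      (A_pow (-1) \<odot> f s_alpha * f s_beta) - (A_pow (-2) \<odot> f s_gamma)"
    if f: "skein_hom_on UNIV f" for f
  proof -
    have add: "f (x + y) = f x + f y" and mult: "f (x * y) = f x * f y"
      and scale: "f (c \<odot> x) = (c \<odot> f x)" for x y c
      using f unfolding skein_hom_on_def by blast+
    have diff: "f (x - y) = f x - f y" for x y
      using add[of x "- y"] by (simp add: skein_hom_uminus[OF f])
    show ?thesis by (simp add: s_gamma_m1_eq diff scale mult)
  qed
  show "xi1 s_gamma_m1 = - s_gamma_m1" "xi2 s_gamma_m1 = - s_gamma_m1"
    "xi3 s_gamma_m1 = s_gamma_m1"
    by (simp_all add: expand skein_map_homs) (simp_all add: s_gamma_m1_eq)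
qed

text \<open>Both sides of each equation are algebra homomorphisms, so it suffices to compare them on
  the generators; there they produce \<open>\<plusminus>\<alpha>\<close>, \<open>\<plusminus>\<beta>\<close>, \<open>\<plusminus>\<gamma>\<^sub>-\<^sub>1\<close>, and the signs agree by the homology
  count above.\<close>

lemma skein_map_xi_intertwine:
  "tau_plus \<circ> xi2 = xi2 \<circ> tau_plus" "tau_plus \<circ> xi1 = xi3 \<circ> tau_plus"
  "tau_plus \<circ> xi3 = xi1 \<circ> tau_plus"
  "tau_minus \<circ> xi1 = xi1 \<circ> tau_minus" "tau_minus \<circ> xi2 = xi3 \<circ> tau_minus"
  "tau_minus \<circ> xi3 = xi2 \<circ> tau_minus"
  "sigma \<circ> xi3 = xi3 \<circ> sigma" "sigma \<circ> xi1 = xi2 \<circ> sigma" "sigma \<circ> xi2 = xi1 \<circ> sigma"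
  by (rule skein_hom_eqI;
      simp add: skein_hom_comp skein_map_homs xi_s_gamma_m1 skein_map_homs[THEN skein_hom_uminus])+

theorem proposition2p6:
  shows "skein_iso_on tau_plus (skein_invariants xi2) (skein_invariants xi2) \<and>
    skein_iso_on tau_plus (skein_invariants xi1) (skein_invariants xi3) \<and>
    skein_iso_on tau_plus (skein_invariants xi3) (skein_invariants xi1) \<and>
    skein_iso_on tau_minus (skein_invariants xi1) (skein_invariants xi1) \<and>
    skein_iso_on tau_minus (skein_invariants xi2) (skein_invariants xi3) \<and>
    skein_iso_on tau_minus (skein_invariants xi3) (skein_invariants xi2) \<and>
    skein_iso_on sigma (skein_invariants xi3) (skein_invariants xi3) \<and>
    skein_iso_on sigma (skein_invariants xi1) (skein_invariants xi2) \<and>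
    skein_iso_on sigma (skein_invariants xi2) (skein_invariants xi1)"
  by (intro conjI skein_iso_on_invariants skein_map_homs bij_skein_maps skein_map_xi_intertwine)

end
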